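(* Let $\langle V,\in\rangle$ be a model of set theory (e.g. of ZFC). Then there is a relation $\in^*$ on $V$, definable in $\langle V,\in\rangle$, such that: (i) $\in^*\neq\in$; (ii) $\langle V,\in^*\rangle$ is isomorphic to $\langle V,\in\rangle$ (so in particular it is a model of set theory); and (iii) the inclusion relation induced by $\in^*$, namely $u\subseteq^* v\iff\forall a\,(a\in^* u\to a\in^* v)$, is identical to the usual inclusion relation $u\subseteq v\iff\forall a\,(a\in u\to a\in v)$.
   Context: $\subseteq$ denotes the inclusion relation defined from $\in$ in the usual way. *)

theory Defs
  imports Main
begin

text \<open>First-order formulas of the language with equality and one binary relation symbol;
  variables are named by natural numbers.\<close>

datatype fm =
    Mem nat nat (infix "\<^bold>\<in>" 55)
  | Eq nat nat (infix "\<^bold>=" 55)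
  | Neg fm ("\<^bold>\<not> _" [50] 50)
  | Conj fm fm (infixr "\<^bold>\<and>" 45)
  | Disj fm fm (infixr "\<^bold>\<or>" 40)
  | Imp fm fm (infixr "\<^bold>\<longrightarrow>" 35)
  | Iff fm fm (infix "\<^bold>\<longleftrightarrow>" 35)
  | Forall nat fm ("(\<^bold>\<forall>_./ _)" [1000, 30] 30)
  | Exists nat fm ("(\<^bold>\<exists>_./ _)" [1000, 30] 30)

primrec fv :: "fm \<Rightarrow> nat set" where
  "fv (x \<^bold>\<in> y) = {x, y}"
| "fv (x \<^bold>= y) = {x, y}"
| "fv (\<^bold>\<not> p) = fv p"
| "fv (p \<^bold>\<and> q) = fv p \<union> fv q"
| "fv (p \<^bold>\<or> q) = fv p \<union> fv q"
| "fv (p \<^bold>\<longrightarrow> q) = fv p \<union> fv q"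
| "fv (p \<^bold>\<longleftrightarrow> q) = fv p \<union> fv q"
| "fv (\<^bold>\<forall>x. p) = fv p - {x}"
| "fv (\<^bold>\<exists>x. p) = fv p - {x}"

text \<open>A structure is a type \<open>'v\<close> (the universe \<open>V\<close>) together with a binary relation on it.\<close>

primrec sat :: "('v \<Rightarrow> 'v \<Rightarrow> bool) \<Rightarrow> (nat \<Rightarrow> 'v) \<Rightarrow> fm \<Rightarrow> bool" where
  "sat E s (x \<^bold>\<in> y) \<longleftrightarrow> E (s x) (s y)"
| "sat E s (x \<^bold>= y) \<longleftrightarrow> s x = s y"
| "sat E s (\<^bold>\<not> p) \<longleftrightarrow> \<not> sat E s p"
| "sat E s (p \<^bold>\<and> q) \<longleftrightarrow> sat E s p \<and> sat E s q"
| "sat E s (p \<^bold>\<or> q) \<longleftrightarrow> sat E s p \<or> sat E s q"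
| "sat E s (p \<^bold>\<longrightarrow> q) \<longleftrightarrow> (sat E s p \<longrightarrow> sat E s q)"
| "sat E s (p \<^bold>\<longleftrightarrow> q) \<longleftrightarrow> (sat E s p \<longleftrightarrow> sat E s q)"
| "sat E s (\<^bold>\<forall>x. p) \<longleftrightarrow> (\<forall>a. sat E (s(x := a)) p)"
| "sat E s (\<^bold>\<exists>x. p) \<longleftrightarrow> (\<exists>a. sat E (s(x := a)) p)"

text \<open>Free variables of axioms are read universally. In particular, the free variables of an
  instance of an axiom scheme are its parameters.\<close>

definition models :: "('v \<Rightarrow> 'v \<Rightarrow> bool) \<Rightarrow> fm set \<Rightarrow> bool" where
  "models E T \<longleftrightarrow> (\<forall>p \<in> T. \<forall>s. sat E s p)"

text \<open>Definability without parameters.\<close>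

definition definable :: "('v \<Rightarrow> 'v \<Rightarrow> bool) \<Rightarrow> ('v \<Rightarrow> 'v \<Rightarrow> bool) \<Rightarrow> bool" where
  "definable E R \<longleftrightarrow> (\<exists>p. fv p \<subseteq> {0, 1} \<and> (\<forall>s. R (s 0) (s 1) \<longleftrightarrow> sat E s p))"

definition isomorphic :: "('v \<Rightarrow> 'v \<Rightarrow> bool) \<Rightarrow> ('w \<Rightarrow> 'w \<Rightarrow> bool) \<Rightarrow> bool" where
  "isomorphic E F \<longleftrightarrow> (\<exists>f. bij f \<and> (\<forall>a b. E a b \<longleftrightarrow> F (f a) (f b)))"

definition inclusion :: "('v \<Rightarrow> 'v \<Rightarrow> bool) \<Rightarrow> 'v \<Rightarrow> 'v \<Rightarrow> bool" where
  "inclusion E u v \<longleftrightarrow> (\<forall>a. E a u \<longrightarrow> E a v)"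

definition extensionality :: fm where
  "extensionality = (\<^bold>\<forall>0. \<^bold>\<forall>1. (\<^bold>\<forall>2. 2 \<^bold>\<in> 0 \<^bold>\<longleftrightarrow> 2 \<^bold>\<in> 1) \<^bold>\<longrightarrow> 0 \<^bold>= 1)"

definition foundation :: fm where
  "foundation =
    (\<^bold>\<forall>0. (\<^bold>\<exists>1. 1 \<^bold>\<in> 0) \<^bold>\<longrightarrow> (\<^bold>\<exists>1. 1 \<^bold>\<in> 0 \<^bold>\<and> \<^bold>\<not> (\<^bold>\<exists>2. 2 \<^bold>\<in> 1 \<^bold>\<and> 2 \<^bold>\<in> 0)))"

definition pairing :: fm where
  "pairing = (\<^bold>\<forall>0. \<^bold>\<forall>1. \<^bold>\<exists>2. \<^bold>\<forall>3. 3 \<^bold>\<in> 2 \<^bold>\<longleftrightarrow> 3 \<^bold>= 0 \<^bold>\<or> 3 \<^bold>= 1)"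

definition union :: fm where
  "union = (\<^bold>\<forall>0. \<^bold>\<exists>1. \<^bold>\<forall>2. 2 \<^bold>\<in> 1 \<^bold>\<longleftrightarrow> (\<^bold>\<exists>3. 3 \<^bold>\<in> 0 \<^bold>\<and> 2 \<^bold>\<in> 3))"

definition powerset :: fm where
  "powerset = (\<^bold>\<forall>0. \<^bold>\<exists>1. \<^bold>\<forall>2. 2 \<^bold>\<in> 1 \<^bold>\<longleftrightarrow> (\<^bold>\<forall>3. 3 \<^bold>\<in> 2 \<^bold>\<longrightarrow> 3 \<^bold>\<in> 0))"

definition infinity :: fm where
  "infinity =
    (\<^bold>\<exists>0. (\<^bold>\<exists>1. 1 \<^bold>\<in> 0 \<^bold>\<and> (\<^bold>\<forall>2. \<^bold>\<not> 2 \<^bold>\<in> 1)) \<^bold>\<and>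
      (\<^bold>\<forall>1. 1 \<^bold>\<in> 0 \<^bold>\<longrightarrow> (\<^bold>\<exists>2. 2 \<^bold>\<in> 0 \<^bold>\<and> (\<^bold>\<forall>3. 3 \<^bold>\<in> 2 \<^bold>\<longleftrightarrow> 3 \<^bold>\<in> 1 \<^bold>\<or> 3 \<^bold>= 1))))"

definition separation :: "fm set" where
  "separation =
    {\<^bold>\<forall>A. \<^bold>\<exists>B. \<^bold>\<forall>x. x \<^bold>\<in> B \<^bold>\<longleftrightarrow> x \<^bold>\<in> A \<^bold>\<and> p | A B x p. distinct [A, B, x] \<and> B \<notin> fv p}"

text \<open>The subformula with \<open>z\<close> says that there is exactly one \<open>y\<close> satisfying \<open>p\<close>.\<close>

definition replacement :: "fm set" where
  "replacement =
    {\<^bold>\<forall>A. (\<^bold>\<forall>x. x \<^bold>\<in> A \<^bold>\<longrightarrow> (\<^bold>\<exists>z. \<^bold>\<forall>y. p \<^bold>\<longleftrightarrow> y \<^bold>= z)) \<^bold>\<longrightarrow>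
      (\<^bold>\<exists>B. \<^bold>\<forall>y. y \<^bold>\<in> B \<^bold>\<longleftrightarrow> (\<^bold>\<exists>x. x \<^bold>\<in> A \<^bold>\<and> p))
     | A B x y z p. distinct [A, B, x, y, z] \<and> B \<notin> fv p \<and> z \<notin> fv p}"

text \<open>Choice: every set of pairwise disjoint nonempty sets has a transversal.\<close>

definition choice :: fm where
  "choice =
    (\<^bold>\<forall>0. (\<^bold>\<forall>1. 1 \<^bold>\<in> 0 \<^bold>\<longrightarrow> (\<^bold>\<exists>2. 2 \<^bold>\<in> 1)) \<^bold>\<and>
        (\<^bold>\<forall>1. \<^bold>\<forall>2. 1 \<^bold>\<in> 0 \<^bold>\<and> 2 \<^bold>\<in> 0 \<^bold>\<and> (\<^bold>\<exists>3. 3 \<^bold>\<in> 1 \<^bold>\<and> 3 \<^bold>\<in> 2) \<^bold>\<longrightarrow> 1 \<^bold>= 2) \<^bold>\<longrightarrow>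
      (\<^bold>\<exists>4. \<^bold>\<forall>1. 1 \<^bold>\<in> 0 \<^bold>\<longrightarrow> (\<^bold>\<exists>2. \<^bold>\<forall>3. 3 \<^bold>\<in> 4 \<^bold>\<and> 3 \<^bold>\<in> 1 \<^bold>\<longleftrightarrow> 3 \<^bold>= 2)))"

definition ZF :: "fm set" where
  "ZF = {extensionality, foundation, pairing, union, powerset, infinity} \<union> separation \<union> replacement"

definition ZFC :: "fm set" where
  "ZFC = insert choice ZF"

lemma ZF_subset_ZFC: "ZF \<subseteq> ZFC"
  by (auto simp: ZFC_def)

end

theory Submission
  imports Defs
begin

text \<open>Let \<open>\<theta>\<close> be the transposition of \<open>\<emptyset>\<close> and \<open>{\<emptyset>}\<close>. The map
  \<open>\<tau> u = {\<theta> x | x \<in> u}\<close> is a definable bijection of \<open>V\<close> that preserves and reflects inclusion, because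
  \<open>\<theta>\<close> is a permutation. Pulling \<open>\<in>\<close> back along \<open>\<tau>\<close> therefore gives an isomorphic copy with the same
  inclusion relation. It differs from \<open>\<in>\<close> since \<open>\<tau> \<emptyset> = \<emptyset>\<close> is not an element of
  \<open>\<tau> {\<emptyset>} = {{\<emptyset>}}\<close>.\<close>

text \<open>Induction on the formula: equality atoms need that \<open>f\<close> is injective, the
  quantifier cases that it is surjective.\<close>

lemma sat_pullback:
  assumes "bij f" and "\<And>a b. E a b \<longleftrightarrow> F (f a) (f b)"
  shows "sat E s p \<longleftrightarrow> sat F (f \<circ> s) p"
proof (induction p arbitrary: s)
  case (Eq x y)
  then show ?case
    using assms(1) by (auto simp: bij_def dest: injD)
next
  case (Forall x p)
  have "(\<forall>a. sat F ((f \<circ> s)(x := f a)) p) \<longleftrightarrow> (\<forall>b. sat F ((f \<circ> s)(x := b)) p)"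
    using assms(1) by (metis bij_pointE)
  then show ?case
    by (simp only: sat.simps Forall fun_upd_comp)
next
  case (Exists x p)
  have "(\<exists>a. sat F ((f \<circ> s)(x := f a)) p) \<longleftrightarrow> (\<exists>b. sat F ((f \<circ> s)(x := b)) p)"
    using assms(1) by (metis bij_pointE)
  then show ?case
    by (simp only: sat.simps Exists fun_upd_comp)
qed (use assms(2) in auto)

lemma models_pullback:
  assumes "bij f" and "\<And>a b. E a b \<longleftrightarrow> F (f a) (f b)" and "models F T"
  shows "models E T"
  using assms(3) sat_pullback[where f = f and E = E and F = F, OF assms(1,2)] by (simp add: models_def)

text \<open>For distinct \<open>z\<close> and \<open>w\<close> this is membership of
  \<open>x\<close> in the image of \<open>u\<close> under the transposition of \<open>z\<close> and
  \<open>w\<close>. The case split avoids function symbols, so that it translates directly into a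
  formula.\<close>

definition swapped_mem :: "('v \<Rightarrow> 'v \<Rightarrow> bool) \<Rightarrow> 'v \<Rightarrow> 'v \<Rightarrow> 'v \<Rightarrow> 'v \<Rightarrow> bool" where
  "swapped_mem E z w x u \<longleftrightarrow>
    x = z \<and> E w u \<or> x = w \<and> E z u \<or> x \<noteq> z \<and> x \<noteq> w \<and> E x u"

definition swapped_mem_fm :: "nat \<Rightarrow> nat \<Rightarrow> nat \<Rightarrow> nat \<Rightarrow> fm" where
  "swapped_mem_fm z w x u =
    (x \<^bold>= z \<^bold>\<and> w \<^bold>\<in> u \<^bold>\<or> x \<^bold>= w \<^bold>\<and> z \<^bold>\<in> u \<^bold>\<or> \<^bold>\<not> (x \<^bold>= z) \<^bold>\<and> \<^bold>\<not> (x \<^bold>= w) \<^bold>\<and> x \<^bold>\<in> u)"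

lemma sat_swapped_mem_fm [simp]:
  "sat E s (swapped_mem_fm z w x u) \<longleftrightarrow> swapped_mem E (s z) (s w) (s x) (s u)"
  by (simp add: swapped_mem_fm_def swapped_mem_def)

lemma fv_swapped_mem_fm [simp]: "fv (swapped_mem_fm z w x u) = {z, w, x, u}"
  by (auto simp: swapped_mem_fm_def)

lemma swapped_mem_transpose:
  assumes "z \<noteq> w"
  shows "swapped_mem E z w x u \<longleftrightarrow> E (if x = z then w else if x = w then z else x) u"
  using assms by (auto simp: swapped_mem_def)

context
  fixes E :: "'v \<Rightarrow> 'v \<Rightarrow> bool"
  assumes ZF: "models E ZF"
begin

lemma sat_axiom: "p \<in> ZF \<Longrightarrow> sat E s p"
  using ZF by (auto simp: models_def)

lemma mem_ext:
  assumes "\<And>x. E x a \<longleftrightarrow> E x b"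
  shows "a = b"
proof -
  have "sat E s extensionality" for s
    by (rule sat_axiom) (simp add: ZF_def)
  then show ?thesis
    using assms by (simp add: extensionality_def)
qed

text \<open>Infinity provides an inductive set, one of whose members is empty.\<close>

lemma ex_empty: "\<exists>z. \<forall>x. \<not> E x z"
proof -
  have "sat E s infinity" for s
    by (rule sat_axiom) (simp add: ZF_def)
  then show ?thesis
    by (auto simp: infinity_def)
qed

lemma ex_pair: "\<exists>c. \<forall>x. E x c \<longleftrightarrow> x = a \<or> x = b"
proof -
  have "sat E s pairing" for s
    by (rule sat_axiom) (simp add: ZF_def)
  then show ?thesis
    by (simp add: pairing_def)
qed

lemma ex_binary_union: "\<exists>c. \<forall>x. E x c \<longleftrightarrow> E x a \<or> E x b"
proof -
  obtain p where "\<And>x. E x p \<longleftrightarrow> x = a \<or> x = b"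
    using ex_pair by blast
  moreover have "sat E s union" for s
    by (rule sat_axiom) (simp add: ZF_def)
  then have "\<exists>c. \<forall>x. E x c \<longleftrightarrow> (\<exists>y. E y p \<and> E x y)"
    by (simp add: union_def)
  ultimately show ?thesis
    by (metis (no_types))
qed

text \<open>Swapping adds at most \<open>z\<close> and \<open>w\<close> to \<open>u\<close>, so
  separation can carve the result out of the union of \<open>u\<close> with {\<open>z\<close>,
  \<open>w\<close>}.\<close>

lemma ex_swapped: "\<exists>v. \<forall>x. E x v \<longleftrightarrow> swapped_mem E z w x u"
proof -
  obtain p where p: "\<And>x. E x p \<longleftrightarrow> x = z \<or> x = w"
    using ex_pair by blast
  obtain A where A: "\<And>x. E x A \<longleftrightarrow> E x u \<or> E x p"
    using ex_binary_union by blast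
  have "(\<^bold>\<forall>0. \<^bold>\<exists>1. \<^bold>\<forall>2. 2 \<^bold>\<in> 1 \<^bold>\<longleftrightarrow> 2 \<^bold>\<in> 0 \<^bold>\<and> swapped_mem_fm 4 5 2 3) \<in> separation"
    unfolding separation_def
    by (rule CollectI, intro exI conjI, rule refl) auto
  \<comment> \<open>Variables 3, 4, 5 are the parameters \<open>u\<close>, \<open>z\<close>,
    \<open>w\<close>; variable 4 receives \<open>z\<close> as the default value of the
    assignment.\<close>
  then have "sat E ((\<lambda>_. z)(3 := u, 5 := w))
      (\<^bold>\<forall>0. \<^bold>\<exists>1. \<^bold>\<forall>2. 2 \<^bold>\<in> 1 \<^bold>\<longleftrightarrow> 2 \<^bold>\<in> 0 \<^bold>\<and> swapped_mem_fm 4 5 2 3)"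
    by (intro sat_axiom) (simp add: ZF_def)
  then have "\<exists>v. \<forall>x. E x v \<longleftrightarrow> E x A \<and> swapped_mem E z w x u"
    by simp
  moreover have "swapped_mem E z w x u \<Longrightarrow> E x A" for x
    using A p by (auto simp: swapped_mem_def)
  ultimately show ?thesis
    by blast
qed

text \<open>The isomorphism \<open>f\<close> is kept explicit because it later carries the axioms of
  \<open>T\<close> over to \<open>mem'\<close>.\<close>

lemma ex_twisted_mem:
  "\<exists>mem'. definable E mem' \<and> mem' \<noteq> E \<and>
    (\<exists>f. bij f \<and> (\<forall>a b. mem' a b \<longleftrightarrow> E (f a) (f b))) \<and>
    (\<forall>u v. inclusion mem' u v \<longleftrightarrow> inclusion E u v)"
proof -
  obtain z where z: "\<And>x. \<not> E x z"
    using ex_empty by blast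
  obtain w where w: "\<And>x. E x w \<longleftrightarrow> x = z"
    using ex_pair[of z z] by auto
  have "z \<noteq> w"
    using z w by blast
  define \<theta> where "\<theta> x = (if x = z then w else if x = w then z else x)" for x
  have \<theta>_\<theta>: "\<theta> (\<theta> x) = x" for x
    using \<open>z \<noteq> w\<close> by (auto simp: \<theta>_def)
  have "\<forall>u. \<exists>v. \<forall>x. E x v \<longleftrightarrow> swapped_mem E z w x u"
    using ex_swapped by blast
  then obtain \<tau> where \<tau>: "\<And>u x. E x (\<tau> u) \<longleftrightarrow> swapped_mem E z w x u"
    by metis
  \<comment> \<open>\<open>\<tau> u\<close> is the image of \<open>u\<close> under
    \<open>\<theta>\<close>, and \<open>\<theta>\<close> is its own inverse.\<close>
  have \<tau>_\<theta>: "E x (\<tau> u) \<longleftrightarrow> E (\<theta> x) u" for x u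
    using \<tau> swapped_mem_transpose[OF \<open>z \<noteq> w\<close>] by (simp add: \<theta>_def)
  have "\<tau> (\<tau> u) = u" for u
    by (rule mem_ext) (simp add: \<tau>_\<theta> \<theta>_\<theta>)
  then have "bij \<tau>"
    by (metis bijI')
  define mem' where "mem' a b \<longleftrightarrow> E (\<tau> a) (\<tau> b)" for a b

  have "\<tau> z = z"
    by (rule mem_ext) (simp add: \<tau>_\<theta> z)
  \<comment> \<open>Here \<open>mem' z w\<close> reduces to \<open>E (\<theta> z) w\<close>, that is
    \<open>E w w\<close>, but the only element of \<open>w\<close> is \<open>z\<close>.\<close>
  then have "\<not> mem' z w"
    using \<open>z \<noteq> w\<close> by (simp add: mem'_def \<tau>_\<theta> w \<theta>_def)
  with w have "mem' \<noteq> E"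
    by metis

  have "inclusion mem' u v \<longleftrightarrow> inclusion E u v" for u v
  proof -
    have "inclusion mem' u v \<longleftrightarrow> (\<forall>a. E (\<theta> (\<tau> a)) u \<longrightarrow> E (\<theta> (\<tau> a)) v)"
      by (simp add: inclusion_def mem'_def \<tau>_\<theta>)
    \<comment> \<open>As \<open>a\<close> runs through the universe, so does
      \<open>\<theta> (\<tau> a)\<close>: the twist only reindexes the quantifier.\<close>
    also have "\<dots> \<longleftrightarrow> inclusion E u v"
      unfolding inclusion_def by (metis \<theta>_\<theta> \<open>bij \<tau>\<close> bij_pointE)
    finally show ?thesis .
  qed

  moreover have "definable E mem'"
  proof -
    \<comment> \<open>Variables 2 and 3 name \<open>z\<close> and \<open>w\<close>, which are
      described rather than used as parameters; 4 and 5 name the images under \<open>\<tau>\<close>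
      of 0 and 1.\<close>
    let ?p = "\<^bold>\<exists>2. \<^bold>\<exists>3. \<^bold>\<exists>4. \<^bold>\<exists>5. (\<^bold>\<forall>6. \<^bold>\<not> 6 \<^bold>\<in> 2) \<^bold>\<and> (\<^bold>\<forall>6. 6 \<^bold>\<in> 3 \<^bold>\<longleftrightarrow> 6 \<^bold>= 2) \<^bold>\<and>
      (\<^bold>\<forall>6. 6 \<^bold>\<in> 4 \<^bold>\<longleftrightarrow> swapped_mem_fm 2 3 6 0) \<^bold>\<and>
      (\<^bold>\<forall>6. 6 \<^bold>\<in> 5 \<^bold>\<longleftrightarrow> swapped_mem_fm 2 3 6 1) \<^bold>\<and> 4 \<^bold>\<in> 5"
    \<comment> \<open>By extensionality each description has exactly one solution, so the
      existential witnesses in \<open>?p\<close> are forced.\<close>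
    have z_iff: "(\<forall>x. \<not> E x z') \<longleftrightarrow> z' = z" for z'
      using z mem_ext by metis
    have w_iff: "(\<forall>x. E x w' \<longleftrightarrow> x = z) \<longleftrightarrow> w' = w" for w'
      using w mem_ext by metis
    have \<tau>_iff: "(\<forall>x. E x v \<longleftrightarrow> swapped_mem E z w x u) \<longleftrightarrow> v = \<tau> u" for u v
      using \<tau> mem_ext by metis
    have "sat E s ?p \<longleftrightarrow> mem' (s 0) (s 1)" for s
    proof -
      have "sat E s ?p \<longleftrightarrow> (\<exists>z' w' c d. (\<forall>x. \<not> E x z') \<and> (\<forall>x. E x w' \<longleftrightarrow> x = z') \<and>
          (\<forall>x. E x c \<longleftrightarrow> swapped_mem E z' w' x (s 0)) \<and>
          (\<forall>x. E x d \<longleftrightarrow> swapped_mem E z' w' x (s 1)) \<and> E c d)"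
        by simp
      also have "\<dots> \<longleftrightarrow> E (\<tau> (s 0)) (\<tau> (s 1))"
        unfolding z_iff by (simp add: w_iff \<tau>_iff cong: conj_cong)
      finally show ?thesis
        by (simp add: mem'_def)
    qed
    moreover have "fv ?p \<subseteq> {0, 1}"
      by auto
    ultimately show ?thesis
      unfolding definable_def by blast
  qed
  ultimately show ?thesis
    using \<open>mem' \<noteq> E\<close> \<open>bij \<tau>\<close> mem'_def by blast
qed

end

theorem theorem1p2:
  fixes mem :: "'v \<Rightarrow> 'v \<Rightarrow> bool" and T :: "fm set"
  assumes "ZF \<subseteq> T" and "models mem T"
  shows "\<exists>mem' :: 'v \<Rightarrow> 'v \<Rightarrow> bool.
    definable mem mem' \<and>
    mem' \<noteq> mem \<and>
    isomorphic mem' mem \<and> models mem' T \<and>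
    (\<forall>u v. inclusion mem' u v \<longleftrightarrow> inclusion mem u v)"
proof -
  have "models mem ZF"
    using assms by (auto simp: models_def)
  from ex_twisted_mem[OF this] obtain mem' f where *: "definable mem mem'" "mem' \<noteq> mem"
      "bij f" "\<And>a b. mem' a b \<longleftrightarrow> mem (f a) (f b)"
      "\<And>u v. inclusion mem' u v \<longleftrightarrow> inclusion mem u v"
    by blast
  have "isomorphic mem' mem"
    using *(3,4) by (auto simp: isomorphic_def)
  \<comment> \<open>Every axiom of \<open>T\<close> holds in \<open>mem'\<close> by transfer along
    \<open>f\<close>.\<close>
  moreover have "models mem' T"
    using models_pullback[where f = f and E = mem' and F = mem, OF *(3,4) assms(2)] .
  ultimately show ?thesis
    using *(1,2,5) by blast
qed

end
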